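(* Let $A$ be an evolution algebra over a field $K$ with associated graph $E$ relative to the natural basis $B=\{e_i\}_{i\in\Lambda}$. The following statements hold. (i) $A$ is a zero annihilator algebra if and only if $E$ is sinkless (has no sinks). (ii) If $A$ is semiprime, then it is a zero annihilator algebra. (iii) If $E^0$ has a subset $S\subsetneq E^0$ such that the graph $E/S$ has a sink, then $A$ has nonzero absolute zero divisors, and hence it is degenerate. Consequently, if $A$ is nondegenerate, then $E$ is sinkless and $A$ is a zero annihilator algebra. (iv) If the graph $E$ contains a vertex that is not the basis of a loop, then $A$ is degenerate.
   Context: Algebras are not assumed associative. An evolution algebra over $K$ is a $K$-algebra $A$ having a basis $B=\{e_i\}_{i\in\Lambda}$ (a natural basis) with $e_ie_j=0$ for all $i\ne j$; it is commutative. Write $e_i^2=\sum_{j\in\Lambda}\omega_{ji}e_j$. The directed graph $E$ associated to $A$ relative to $B$ has vertex set $E^0=\{e_i\}_{i\in\Lambda}$ and exactly one edge from $e_i$ to $e_j$ if $\omega_{ji}\neq 0$, and none otherwise. A sink is a vertex which is the source of no edge. A vertex is the basis of a loop if there is an edge from it to itself. For $S\subseteq E^0$, the graph $E/S$ has vertex set $E^0\setminus S$ and edges those edges of $E$ whose source and range both lie outside $S$. The annihilator of $A$ is $\{x\in A: xA=Ax=0\}$; $A$ is a zero annihilator algebra if this is $0$. $A$ is semiprime if any ideal $I$ of $A$ with $I^2=0$ is $0$. An absolute zero divisor is an element $x\in A$ with $(xA)x=0$; $A$ is nondegenerate if its only absolute zero divisor is $0$, and degenerate otherwise. *)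

theory Defs
  imports Main "Graph_Theory.Digraph_Component"
begin

text \<open>The carrier of an algebra is the whole type \<open>'a\<close>; neither associativity,
  commutativity nor a unit is assumed.\<close>

locale nonassoc_algebra = vector_space scale
  for scale :: "'k::field \<Rightarrow> 'a::ab_group_add \<Rightarrow> 'a" +
  fixes mul :: "'a \<Rightarrow> 'a \<Rightarrow> 'a"
  assumes linear_mul_right: "Vector_Spaces.linear scale scale (\<lambda>y. mul x y)"
    and linear_mul_left: "Vector_Spaces.linear scale scale (\<lambda>x. mul x y)"

text \<open>A basis is a set of vectors, so it serves as its own index set; it may be infinite.\<close>

definition natural_basis ::
    "('k::field \<Rightarrow> 'a::ab_group_add \<Rightarrow> 'a) \<Rightarrow> ('a \<Rightarrow> 'a \<Rightarrow> 'a) \<Rightarrow> 'a set \<Rightarrow> bool" where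
  "natural_basis scale mul B \<longleftrightarrow>
     \<not> module.dependent scale B \<and> module.span scale B = UNIV \<and>
     (\<forall>u\<in>B. \<forall>v\<in>B. u \<noteq> v \<longrightarrow> mul u v = 0)"

locale evolution_algebra = nonassoc_algebra +
  assumes has_natural_basis: "\<exists>B. natural_basis scale mul B"

text \<open>\<open>struct_coeff scale mul B v u\<close> is the coefficient of \<open>v\<close> in \<open>mul u u\<close>, that is
  $\omega_{ji}$ for $v = e_j$ and $u = e_i$.\<close>

definition struct_coeff ::
    "('k::field \<Rightarrow> 'a::ab_group_add \<Rightarrow> 'a) \<Rightarrow> ('a \<Rightarrow> 'a \<Rightarrow> 'a) \<Rightarrow> 'a set \<Rightarrow> 'a \<Rightarrow> 'a \<Rightarrow> 'k" where
  "struct_coeff scale mul B v u = module.representation scale B (mul u u) v"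

definition assoc_graph ::
    "('k::field \<Rightarrow> 'a::ab_group_add \<Rightarrow> 'a) \<Rightarrow> ('a \<Rightarrow> 'a \<Rightarrow> 'a) \<Rightarrow> 'a set \<Rightarrow> ('a, 'a \<times> 'a) pre_digraph" where
  "assoc_graph scale mul B =
     \<lparr> verts = B, arcs = {(u, v). u \<in> B \<and> v \<in> B \<and> struct_coeff scale mul B v u \<noteq> 0},
       tail = fst, head = snd \<rparr>"

definition is_sink :: "('v, 'e) pre_digraph \<Rightarrow> 'v \<Rightarrow> bool" where
  "is_sink G v \<longleftrightarrow> v \<in> verts G \<and> out_arcs G v = {}"

definition sinkless :: "('v, 'e) pre_digraph \<Rightarrow> bool" where
  "sinkless G \<longleftrightarrow> \<not> (\<exists>v. is_sink G v)"

definition loop_basis :: "('v, 'e) pre_digraph \<Rightarrow> 'v \<Rightarrow> bool" where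
  "loop_basis G v \<longleftrightarrow> (\<exists>e\<in>arcs G. tail G e = v \<and> head G e = v)"

definition remove_verts :: "('v, 'e) pre_digraph \<Rightarrow> 'v set \<Rightarrow> ('v, 'e) pre_digraph" where
  "remove_verts G S = G \<restriction> (verts G - S)"

definition annihilator :: "('a::zero \<Rightarrow> 'a \<Rightarrow> 'a) \<Rightarrow> 'a set" where
  "annihilator mul = {x. \<forall>a. mul x a = 0 \<and> mul a x = 0}"

definition zero_annihilator :: "('a::zero \<Rightarrow> 'a \<Rightarrow> 'a) \<Rightarrow> bool" where
  "zero_annihilator mul \<longleftrightarrow> annihilator mul = {0}"

definition is_ideal ::
    "('k::field \<Rightarrow> 'a::ab_group_add \<Rightarrow> 'a) \<Rightarrow> ('a \<Rightarrow> 'a \<Rightarrow> 'a) \<Rightarrow> 'a set \<Rightarrow> bool" where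
  "is_ideal scale mul I \<longleftrightarrow>
     module.subspace scale I \<and> (\<forall>x\<in>I. \<forall>a. mul x a \<in> I \<and> mul a x \<in> I)"

text \<open>As usual, a product of subspaces is the linear span of the products of their elements.\<close>

definition subspace_prod ::
    "('k::field \<Rightarrow> 'a::ab_group_add \<Rightarrow> 'a) \<Rightarrow> ('a \<Rightarrow> 'a \<Rightarrow> 'a) \<Rightarrow> 'a set \<Rightarrow> 'a set \<Rightarrow> 'a set" where
  "subspace_prod scale mul I J = module.span scale {mul x y | x y. x \<in> I \<and> y \<in> J}"

definition semiprime ::
    "('k::field \<Rightarrow> 'a::ab_group_add \<Rightarrow> 'a) \<Rightarrow> ('a \<Rightarrow> 'a \<Rightarrow> 'a) \<Rightarrow> bool" where
  "semiprime scale mul \<longleftrightarrow>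
     (\<forall>I. is_ideal scale mul I \<longrightarrow> subspace_prod scale mul I I = {0} \<longrightarrow> I = {0})"

definition absolute_zero_divisor :: "('a::zero \<Rightarrow> 'a \<Rightarrow> 'a) \<Rightarrow> 'a \<Rightarrow> bool" where
  "absolute_zero_divisor mul x \<longleftrightarrow> (\<forall>a. mul (mul x a) x = 0)"

definition nondegenerate :: "('a::zero \<Rightarrow> 'a \<Rightarrow> 'a) \<Rightarrow> bool" where
  "nondegenerate mul \<longleftrightarrow> (\<forall>x. absolute_zero_divisor mul x \<longrightarrow> x = 0)"

abbreviation degenerate :: "('a::zero \<Rightarrow> 'a \<Rightarrow> 'a) \<Rightarrow> bool" where
  "degenerate mul \<equiv> \<not> nondegenerate mul"

end

theory Submission
  imports Defs
begin

text \<open>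
  Multiplying by a natural basis vector \<open>u\<close> sees only one coordinate: both \<open>x u\<close> and \<open>u x\<close> equal
  \<open>c u\<^sup>2\<close>, where \<open>c\<close> is the \<open>u\<close>-coordinate of \<open>x\<close> (\<open>mul_basis_right\<close>, \<open>mul_basis_left\<close>).
  Everything about the annihilator and about absolute zero divisors is read off from this.

  A sink is a basis vector with \<open>u\<^sup>2 = 0\<close>, so it annihilates the algebra. Conversely, if no basis
  vector squares to zero, an annihilating \<open>x\<close> has \<open>0 = x u = c u\<^sup>2\<close> for each \<open>u\<close>, so all its
  coordinates vanish. The annihilator is an ideal of square zero in any algebra, so a semiprime
  algebra has zero annihilator.

  A basis vector \<open>u\<close> without a loop has \<open>u\<close>-coordinate \<open>0\<close> in \<open>u\<^sup>2\<close>, so \<open>u\<^sup>2 u = 0\<close>; since \<open>u a\<close> is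
  always a multiple of \<open>u\<^sup>2\<close>, such a \<open>u\<close> is an absolute zero divisor
  (\<open>absolute_zero_divisor_if_no_loop\<close>). A sink of \<open>E/S\<close> carries no loop, because a loop survives
  the deletion of any set of other vertices; hence the statement on quotient graphs is an instance
  of this, and its case of empty \<open>S\<close> shows that nondegeneracy forces \<open>E\<close> to be sinkless.
\<close>

context nonassoc_algebra
begin

lemma mul_add_left: "mul (x + y) z = mul x z + mul y z"
  using linear_mul_left[of z] by (simp add: Vector_Spaces.linear_iff)

lemma mul_scale_left: "mul (scale c x) z = scale c (mul x z)"
  using linear_mul_left[of z] by (simp add: Vector_Spaces.linear_iff)

lemma mul_zero_left: "mul 0 z = 0"
  using mul_scale_left[of 0 0 z] by simp

lemma mul_add_right: "mul z (x + y) = mul z x + mul z y"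
  using linear_mul_right[of z] by (simp add: Vector_Spaces.linear_iff)

lemma mul_scale_right: "mul z (scale c x) = scale c (mul z x)"
  using linear_mul_right[of z] by (simp add: Vector_Spaces.linear_iff)

lemma mul_zero_right: "mul z 0 = 0"
  using mul_scale_right[of z 0 0] by simp

lemma is_ideal_annihilator: "is_ideal scale mul (annihilator mul)"
  unfolding is_ideal_def annihilator_def
  by (auto simp: mul_add_left mul_scale_left mul_zero_left
      mul_add_right mul_scale_right mul_zero_right intro!: subspaceI)

lemma zero_annihilator_if_semiprime:
  assumes "semiprime scale mul"
  shows "zero_annihilator mul"
proof -
  have "{mul x y |x y. x \<in> annihilator mul \<and> y \<in> annihilator mul} \<subseteq> {0}"
    by (auto simp: annihilator_def)
  then have "subspace_prod scale mul (annihilator mul) (annihilator mul) \<subseteq> {0}"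
    unfolding subspace_prod_def by (rule span_minimal) (rule subspace_single_0)
  then have "subspace_prod scale mul (annihilator mul) (annihilator mul) = {0}"
    unfolding subspace_prod_def using span_zero by blast
  then show ?thesis
    using assms is_ideal_annihilator unfolding semiprime_def zero_annihilator_def by blast
qed

end

locale algebra_with_natural_basis = nonassoc_algebra +
  fixes B
  assumes natural_basis: "natural_basis scale mul B"
begin

lemma independent_B: "independent B"
  and in_span_B: "x \<in> span B"
  and mul_distinct_basis: "u \<in> B \<Longrightarrow> v \<in> B \<Longrightarrow> u \<noteq> v \<Longrightarrow> mul u v = 0"
  using natural_basis unfolding natural_basis_def by auto

lemma basis_nonzero: "u \<in> B \<Longrightarrow> u \<noteq> 0"
  using independent_B dependent_zero by blast

lemma eq_zero_iff_coordinates: "x = 0 \<longleftrightarrow> (\<forall>u\<in>B. representation B x u = 0)"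
proof
  assume "\<forall>u\<in>B. representation B x u = 0"
  then have "representation B x = representation B 0"
    using representation_ne_zero[of B x] by (auto simp: representation_zero)
  then show "x = 0"
    using independent_B in_span_B by (metis sum_nonzero_representation_eq)
qed (simp add: representation_zero)

text \<open>Both sides are linear in \<open>x\<close>, so orthogonality of distinct basis vectors gives the formula.\<close>

lemma mul_basis_right:
  assumes "u \<in> B"
  shows "mul x u = scale (representation B x u) (mul u u)"
  using in_span_B[of x]
proof (induction rule: span_induct_alt)
  case base
  show ?case by (simp add: mul_zero_left representation_zero)
next
  case (step c v y)
  have "representation B (scale c v + y) u =
      c * representation B v u + representation B y u"
    by (simp add: independent_B in_span_B representation_add representation_scale)
  moreover have "mul v u = scale (representation B v u) (mul u u)"
    using step(1) assms independent_B mul_distinct_basis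
    by (auto simp: representation_basis)
  ultimately show ?case
    using step by (simp add: mul_add_left mul_scale_left scale_left_distrib)
qed

lemma mul_basis_left:
  assumes "u \<in> B"
  shows "mul u x = scale (representation B x u) (mul u u)"
  using in_span_B[of x]
proof (induction rule: span_induct_alt)
  case base
  show ?case by (simp add: mul_zero_right representation_zero)
next
  case (step c v y)
  have "representation B (scale c v + y) u =
      c * representation B v u + representation B y u"
    by (simp add: independent_B in_span_B representation_add representation_scale)
  moreover have "mul u v = scale (representation B v u) (mul u u)"
    using step(1) assms independent_B mul_distinct_basis
    by (auto simp: representation_basis)
  ultimately show ?case
    using step by (simp add: mul_add_right mul_scale_right scale_left_distrib)
qed

lemma is_sink_iff_square_zero:
  "is_sink (assoc_graph scale mul B) u \<longleftrightarrow> u \<in> B \<and> mul u u = 0"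
proof -
  have "is_sink (assoc_graph scale mul B) u \<longleftrightarrow>
      u \<in> B \<and> (\<forall>v\<in>B. representation B (mul u u) v = 0)"
    unfolding is_sink_def out_arcs_def assoc_graph_def struct_coeff_def by auto
  then show ?thesis
    unfolding eq_zero_iff_coordinates[of "mul u u"] .
qed

lemma loop_basis_iff:
  "loop_basis (assoc_graph scale mul B) u \<longleftrightarrow> u \<in> B \<and> representation B (mul u u) u \<noteq> 0"
  by (auto simp: loop_basis_def assoc_graph_def struct_coeff_def)

lemma zero_annihilator_iff_sinkless:
  "zero_annihilator mul \<longleftrightarrow> sinkless (assoc_graph scale mul B)"
proof
  assume zero: "zero_annihilator mul"
  have "mul u u \<noteq> 0" if "u \<in> B" for u
  proof
    assume "mul u u = 0"
    then have "mul u a = 0" and "mul a u = 0" for a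
      by (simp_all only: mul_basis_left[OF that, of a] mul_basis_right[OF that, of a]
          scale_zero_right)
    then have "u \<in> annihilator mul"
      by (simp add: annihilator_def)
    then show False
      using zero that basis_nonzero by (auto simp: zero_annihilator_def)
  qed
  then show "sinkless (assoc_graph scale mul B)"
    by (simp add: sinkless_def is_sink_iff_square_zero)
next
  assume sinkless: "sinkless (assoc_graph scale mul B)"
  have "x = 0" if "x \<in> annihilator mul" for x
  proof -
    have "representation B x u = 0" if "u \<in> B" for u
    proof -
      have "scale (representation B x u) (mul u u) = 0"
        unfolding mul_basis_right[OF \<open>u \<in> B\<close>, of x, symmetric]
        using \<open>x \<in> annihilator mul\<close> by (simp add: annihilator_def)
      then show ?thesis
        using sinkless \<open>u \<in> B\<close> by (auto simp: sinkless_def is_sink_iff_square_zero)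
    qed
    then show ?thesis
      unfolding eq_zero_iff_coordinates[of x] by blast
  qed
  moreover have "0 \<in> annihilator mul"
    by (simp add: annihilator_def mul_zero_left mul_zero_right)
  ultimately show "zero_annihilator mul"
    unfolding zero_annihilator_def by blast
qed

text \<open>The product \<open>(u a) u\<close> is a multiple of \<open>u\<^sup>2 u\<close>, which is itself the \<open>u\<close>-coordinate of \<open>u\<^sup>2\<close>
  times \<open>u\<^sup>2\<close>; that coordinate is what a loop at \<open>u\<close> records.\<close>

lemma absolute_zero_divisor_if_no_loop:
  assumes "u \<in> B" and "\<not> loop_basis (assoc_graph scale mul B) u"
  shows "absolute_zero_divisor mul u"
  unfolding absolute_zero_divisor_def
proof
  fix a
  have "mul (mul u u) u = 0"
    using assms by (simp add: mul_basis_right[of u "mul u u"] loop_basis_iff)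
  moreover have "mul (mul u a) u = scale (representation B a u) (mul (mul u u) u)"
    using assms(1) by (simp add: mul_basis_left[of u a] mul_scale_left)
  ultimately show "mul (mul u a) u = 0"
    by simp
qed

lemma degenerate_if_no_loop:
  assumes "u \<in> B" and "\<not> loop_basis (assoc_graph scale mul B) u"
  shows "degenerate mul"
  using absolute_zero_divisor_if_no_loop[OF assms] basis_nonzero[OF assms(1)]
  by (auto simp: nondegenerate_def)

end

lemma no_loop_at_sink_of_remove_verts:
  assumes "is_sink (remove_verts G S) v"
  shows "v \<in> verts G" and "\<not> loop_basis G v"
  using assms
  by (auto simp: is_sink_def remove_verts_def loop_basis_def out_arcs_def induce_subgraph_def)
    metis

theorem proposition3p1:
  fixes scale :: "'k::field \<Rightarrow> 'a::ab_group_add \<Rightarrow> 'a"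
    and mul :: "'a \<Rightarrow> 'a \<Rightarrow> 'a"
    and B :: "'a set"
    and E :: "('a, 'a \<times> 'a) pre_digraph"
  assumes "evolution_algebra scale mul"
    and "natural_basis scale mul B"
    and "E = assoc_graph scale mul B"
  shows "(zero_annihilator mul \<longleftrightarrow> sinkless E)
    \<and> (semiprime scale mul \<longrightarrow> zero_annihilator mul)
    \<and> ((\<exists>S. S \<subset> verts E \<and> (\<exists>v. is_sink (remove_verts E S) v)) \<longrightarrow>
         (\<exists>x. x \<noteq> 0 \<and> absolute_zero_divisor mul x) \<and> degenerate mul)
    \<and> (nondegenerate mul \<longrightarrow> sinkless E \<and> zero_annihilator mul)
    \<and> ((\<exists>v\<in>verts E. \<not> loop_basis E v) \<longrightarrow> degenerate mul)"
proof -
  interpret algebra_with_natural_basis scale mul B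
    using assms(1,2)
    by (simp add: algebra_with_natural_basis_def algebra_with_natural_basis_axioms_def
        evolution_algebra_def)
  have verts_E: "verts E = B"
    by (simp add: assms(3) assoc_graph_def)
  have zero_divisor: "v \<noteq> 0 \<and> absolute_zero_divisor mul v"
    if "is_sink (remove_verts E S) v" for S v
    using no_loop_at_sink_of_remove_verts[OF that] verts_E assms(3)
      absolute_zero_divisor_if_no_loop basis_nonzero by auto
  then have degenerate: "degenerate mul" if "is_sink (remove_verts E S) v" for S v
    using that unfolding nondegenerate_def by blast
  have sinkless: "sinkless E" if "nondegenerate mul"
  proof -
    have "\<not> is_sink E v" for v
    proof
      assume "is_sink E v"
      then have "is_sink (remove_verts E {}) v"
        by (auto simp: is_sink_def remove_verts_def out_arcs_def induce_subgraph_def)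
      then show False
        using degenerate that by blast
    qed
    then show ?thesis
      by (simp add: sinkless_def)
  qed
  show ?thesis
    using zero_annihilator_iff_sinkless[folded assms(3)] zero_annihilator_if_semiprime
      sinkless zero_divisor degenerate degenerate_if_no_loop[folded assms(3)]
    unfolding verts_E by blast
qed

end
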